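(* Let $x\in B_4$ be a non-trivial braid with classical left normal form $N_{\sf c}(x)=\Delta^p s_1\cdots s_r$. If $s_i\neq \sigma_2\sigma_1\sigma_3$ for all $i=1,\ldots,r$, then $\rho_4(x)\neq 1$ (that is, $\rho_4(x)$ is not the identity matrix).
   Context: $B_4$ is the braid group on 4 strands with Artin generators $\sigma_1,\sigma_2,\sigma_3$. The reduced Burau representation $\rho_4:B_4\to GL(3,\mathbb Z[q^{\pm1}])$ is the homomorphism ($\rho_4(xy)=\rho_4(x)\rho_4(y)$) given by $$\rho_4(\sigma_1)=\begin{pmatrix}-q&0&0\\1&1&0\\0&0&1\end{pmatrix},\quad \rho_4(\sigma_2)=\begin{pmatrix}1&q&0\\0&-q&0\\0&1&1\end{pmatrix},\quad \rho_4(\sigma_3)=\begin{pmatrix}1&0&0\\0&1&q\\0&0&-q\end{pmatrix}.$$ Classical Garside structure: $B_4^+$ is the monoid of positive braids (words in the $\sigma_i$ with only positive exponents), and $x\preccurlyeq_{\sf c}y$ iff $x^{-1}y\in B_4^+$; this is a lattice order on $B_4$. Let $\Delta=(\sigma_1\sigma_2\sigma_3)(\sigma_1\sigma_2)(\sigma_1)$. Simple elements are the braids $s$ with $1\preccurlyeq_{\sf c}s\preccurlyeq_{\sf c}\Delta$. An ordered pair $(s,s')$ of simple elements is left-weighted if $\Delta\wedge_{\sf c}(ss')=s$, where $\wedge_{\sf c}$ is the greatest common divisor (meet) for $\preccurlyeq_{\sf c}$. Every $x\in B_4$ has a unique decomposition $N_{\sf c}(x)=\Delta^p s_1\cdots s_r$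 with $p\in\mathbb Z$, $s_1,\ldots,s_r$ simple elements, $s_1\ne\Delta$, $s_r\ne1$, and $(s_i,s_{i+1})$ left-weighted for $1\le i\le r-1$; this is the classical (left) normal form of $x$, and $s_1,\dots,s_r$ are its factors. *)

theory Defs
  imports "HOL-Analysis.Analysis" "HOL-Library.Poly_Mapping"
begin

section \<open>The braid group on four strands\<close>

datatype artin = S1 | S2 | S3

text \<open>A letter \<open>(i, True)\<close> stands for \<open>\<sigma>\<^sub>i\<close>, and \<open>(i, False)\<close> for its formal inverse.\<close>

type_synonym braid_word = "(artin \<times> bool) list"

inductive braid_rel :: "braid_word \<Rightarrow> braid_word \<Rightarrow> bool" where
  cancel: "braid_rel [(i, b), (i, \<not> b)] []"
| braid12: "braid_rel [(S1, True), (S2, True), (S1, True)] [(S2, True), (S1, True), (S2, True)]"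
| braid23: "braid_rel [(S2, True), (S3, True), (S2, True)] [(S3, True), (S2, True), (S3, True)]"
| comm13: "braid_rel [(S1, True), (S3, True)] [(S3, True), (S1, True)]"

inductive braid_eq :: "braid_word \<Rightarrow> braid_word \<Rightarrow> bool" where
  base: "braid_rel l r \<Longrightarrow> braid_eq (u @ l @ v) (u @ r @ v)"
| refl: "braid_eq u u"
| sym: "braid_eq u v \<Longrightarrow> braid_eq v u"
| trans: "braid_eq u v \<Longrightarrow> braid_eq v w \<Longrightarrow> braid_eq u w"

lemma braid_eq_context: "braid_eq u v \<Longrightarrow> braid_eq (a @ u @ b) (a @ v @ b)"
proof (induction rule: braid_eq.induct)
  case (base l r u v)
  then show ?case using braid_eq.base[of l r "a @ u" "v @ b"] by simp
qed (auto intro: braid_eq.intros)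

lemma braid_eq_append:
  assumes "braid_eq u u'" "braid_eq v v'"
  shows "braid_eq (u @ v) (u' @ v')"
  using braid_eq_context[OF assms(1), of "[]" v] braid_eq_context[OF assms(2), of u' "[]"]
  by (auto intro: braid_eq.trans)

definition inv_word :: "braid_word \<Rightarrow> braid_word" where
  "inv_word w = rev (map (\<lambda>(i, b). (i, \<not> b)) w)"

lemma inv_word_simps [simp]:
  "inv_word [] = []"
  "inv_word ((i, b) # w) = inv_word w @ [(i, \<not> b)]"
  "inv_word (u @ v) = inv_word v @ inv_word u"
  "inv_word (inv_word w) = w"
  by (auto simp: inv_word_def rev_map o_def case_prod_unfold)

lemma braid_eq_inv_word_left: "braid_eq (inv_word w @ w) []"
proof (induction w)
  case Nil
  show ?case by (simp add: braid_eq.refl)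
next
  case (Cons a w)
  obtain i b where a: "a = (i, b)" by force
  have "braid_eq (inv_word w @ [(i, \<not> b), (i, \<not> \<not> b)] @ w) (inv_word w @ [] @ w)"
    by (intro braid_eq.base braid_rel.cancel)
  with Cons show ?case by (auto simp: a intro: braid_eq.trans)
qed

lemma braid_eq_inv_word_right: "braid_eq (w @ inv_word w) []"
  using braid_eq_inv_word_left[of "inv_word w"] by simp

lemma braid_eq_inv_word:
  assumes "braid_eq u v"
  shows "braid_eq (inv_word u) (inv_word v)"
proof -
  have "braid_eq (inv_word u @ u @ inv_word v) (inv_word u @ v @ inv_word v)"
    by (rule braid_eq_context[OF assms])
  moreover have "braid_eq (inv_word u @ v @ inv_word v) (inv_word u @ [])"
    by (intro braid_eq_append braid_eq.refl braid_eq_inv_word_right)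
  moreover have "braid_eq ((inv_word u @ u) @ inv_word v) ([] @ inv_word v)"
    by (intro braid_eq_append braid_eq.refl braid_eq_inv_word_left)
  ultimately show ?thesis
    unfolding append_assoc append_Nil append_Nil2 by (blast intro: braid_eq.sym braid_eq.trans)
qed

quotient_type braid4 = braid_word / braid_eq
  by (intro equivpI reflpI sympI transpI) (blast intro: braid_eq.intros)+

instantiation braid4 :: "{monoid_mult, inverse}"
begin

lift_definition one_braid4 :: braid4 is "[]" .

lift_definition times_braid4 :: "braid4 \<Rightarrow> braid4 \<Rightarrow> braid4" is "(@)"
  by (rule braid_eq_append)

lift_definition inverse_braid4 :: "braid4 \<Rightarrow> braid4" is inv_word
  by (rule braid_eq_inv_word)

definition divide_braid4 :: "braid4 \<Rightarrow> braid4 \<Rightarrow> braid4" where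
  "divide_braid4 x y = x * inverse y"

instance
  by standard (transfer; simp add: braid_eq.refl)+

end

lemma group_braid4: "group (*) (1 :: braid4) inverse"
proof
  fix x :: braid4
  show "inverse x * x = 1" by transfer (rule braid_eq_inv_word_left)
qed (simp_all add: mult.assoc)

lift_definition \<sigma> :: "artin \<Rightarrow> braid4" is "\<lambda>i. [(i, True)]" .

lemma artin_relations:
  "\<sigma> S1 * \<sigma> S2 * \<sigma> S1 = \<sigma> S2 * \<sigma> S1 * \<sigma> S2"
  "\<sigma> S2 * \<sigma> S3 * \<sigma> S2 = \<sigma> S3 * \<sigma> S2 * \<sigma> S3"
  "\<sigma> S1 * \<sigma> S3 = \<sigma> S3 * \<sigma> S1"
  by (transfer; use braid_eq.base[of _ _ "[]" "[]"] braid_rel.intros in force)+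


section \<open>The classical Garside structure\<close>

definition positive_braids :: "braid4 set" where
  "positive_braids = {prod_list (map \<sigma> w) | w. True}"

definition prefix_le :: "braid4 \<Rightarrow> braid4 \<Rightarrow> bool" (infix \<open>\<preceq>\<^sub>c\<close> 50) where
  "x \<preceq>\<^sub>c y \<longleftrightarrow> inverse x * y \<in> positive_braids"

text \<open>\<open>is_meet d x y\<close> reads: the meet of \<open>x\<close> and \<open>y\<close> for \<open>\<preceq>\<^sub>c\<close> exists and is \<open>d\<close>.
  Using a relation avoids having to prove first that \<open>\<preceq>\<^sub>c\<close> is a lattice order.\<close>

definition is_meet :: "braid4 \<Rightarrow> braid4 \<Rightarrow> braid4 \<Rightarrow> bool" where
  "is_meet d x y \<longleftrightarrow> d \<preceq>\<^sub>c x \<and> d \<preceq>\<^sub>c y \<and> (\<forall>e. e \<preceq>\<^sub>c x \<and> e \<preceq>\<^sub>c y \<longrightarrow> e \<preceq>\<^sub>c d)"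

definition Garside :: braid4 (\<open>\<Delta>\<close>) where
  "\<Delta> = (\<sigma> S1 * \<sigma> S2 * \<sigma> S3) * (\<sigma> S1 * \<sigma> S2) * \<sigma> S1"

definition simple_braids :: "braid4 set" where
  "simple_braids = {s. 1 \<preceq>\<^sub>c s \<and> s \<preceq>\<^sub>c \<Delta>}"

definition left_weighted :: "braid4 \<Rightarrow> braid4 \<Rightarrow> bool" where
  "left_weighted s s' \<longleftrightarrow> is_meet s \<Delta> (s * s')"

text \<open>\<open>left_normal_form x p ss\<close> reads: the classical left normal form of \<open>x\<close> is
  \<open>\<Delta>\<^sup>p s\<^sub>1 \<cdots> s\<^sub>r\<close> with \<open>ss = [s\<^sub>1, \<dots>, s\<^sub>r]\<close>; the list may be empty (\<open>r = 0\<close>).\<close>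

definition left_normal_form :: "braid4 \<Rightarrow> int \<Rightarrow> braid4 list \<Rightarrow> bool" where
  "left_normal_form x p ss \<longleftrightarrow>
     x = \<Delta> powi p * prod_list ss \<and>
     set ss \<subseteq> simple_braids \<and>
     (ss \<noteq> [] \<longrightarrow> hd ss \<noteq> \<Delta> \<and> last ss \<noteq> 1) \<and>
     (\<forall>i. Suc i < length ss \<longrightarrow> left_weighted (ss ! i) (ss ! Suc i))"


section \<open>The reduced Burau representation\<close>

text \<open>Finitely supported functions from \<open>int\<close> (exponents) to \<open>int\<close> (coefficients) with the
  convolution product are exactly the Laurent polynomials over the integers.\<close>

type_synonym laurent = "int \<Rightarrow>\<^sub>0 int"

definition q :: laurent where "q = Poly_Mapping.single 1 1"

definition q_inv :: laurent where "q_inv = Poly_Mapping.single (-1) 1"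

lemma q_q_inv [simp]: "q * q_inv = 1" "q_inv * q = 1"
  by (simp_all add: q_def q_inv_def Poly_Mapping.mult_single flip: Poly_Mapping.single_one)

fun burau_gen :: "artin \<Rightarrow> laurent ^ 3 ^ 3" where
  "burau_gen S1 = vector [vector [-q, 0, 0], vector [1, 1, 0], vector [0, 0, 1]]"
| "burau_gen S2 = vector [vector [1, q, 0], vector [0, -q, 0], vector [0, 1, 1]]"
| "burau_gen S3 = vector [vector [1, 0, 0], vector [0, 1, q], vector [0, 0, -q]]"

fun burau_gen_inv :: "artin \<Rightarrow> laurent ^ 3 ^ 3" where
  "burau_gen_inv S1 = vector [vector [-q_inv, 0, 0], vector [q_inv, 1, 0], vector [0, 0, 1]]"
| "burau_gen_inv S2 = vector [vector [1, 1, 0], vector [0, -q_inv, 0], vector [0, q_inv, 1]]"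
| "burau_gen_inv S3 = vector [vector [1, 0, 0], vector [0, 1, 1], vector [0, 0, -q_inv]]"

lemma burau_gen_inv:
  "burau_gen i ** burau_gen_inv i = mat 1" "burau_gen_inv i ** burau_gen i = mat 1"
  by (cases i; simp add: vec_eq_iff forall_3 matrix_matrix_mult_def sum_3 mat_def)+

fun burau_word :: "braid_word \<Rightarrow> laurent ^ 3 ^ 3" where
  "burau_word [] = mat 1"
| "burau_word ((i, b) # w) = (if b then burau_gen i else burau_gen_inv i) ** burau_word w"

lemma burau_word_append: "burau_word (u @ v) = burau_word u ** burau_word v"
  by (induction u rule: burau_word.induct) (auto simp: matrix_mul_assoc)

lemma burau_word_rel: "braid_rel l r \<Longrightarrow> burau_word l = burau_word r"
proof (induction rule: braid_rel.induct)
  case (cancel i b)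
  show ?case by (simp add: burau_gen_inv)
qed (simp_all add: vec_eq_iff forall_3 matrix_matrix_mult_def sum_3 mat_def algebra_simps)

lemma burau_word_cong: "braid_eq u v \<Longrightarrow> burau_word u = burau_word v"
  by (induction rule: braid_eq.induct) (auto simp: burau_word_append burau_word_rel)

lift_definition burau4 :: "braid4 \<Rightarrow> laurent ^ 3 ^ 3" is burau_word
  by (rule burau_word_cong)

lemma burau4_one: "burau4 1 = mat 1"
  by transfer simp

lemma burau4_mult: "burau4 (x * y) = burau4 x ** burau4 y"
  by transfer (rule burau_word_append)

lemma burau4_generator: "burau4 (\<sigma> i) = burau_gen i"
  by transfer simp

lemma invertible_burau4: "invertible (burau4 x)"
proof -
  interpret group "(*)" "1 :: braid4" inverse by (rule group_braid4)
  have "burau4 x ** burau4 (inverse x) = mat 1" "burau4 (inverse x) ** burau4 x = mat 1"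
    by (simp_all add: burau4_one flip: burau4_mult)
  then show ?thesis unfolding invertible_def by blast
qed

end

theory Submission
  imports Defs
begin

text \<open>
  Give the monomial \<open>q\<^sup>e\<close> in row \<open>i\<close>, column \<open>k\<close> of a matrix the level \<open>2e + i - k\<close>; this grading is
  compatible with matrix products and makes the three nonzero entries of the image of \<open>\<Delta>\<close> have the
  same level. Consider the set of rows in which the highest level of a matrix occurs.

  If \<open>s\<close> is a proper simple braid with a single finishing generator \<open>j\<close>, then multiplication by
  \<open>\<rho>\<^sub>4(s)\<close> from the left turns any matrix that attains its highest level in row \<open>j\<close> into one that
  attains it exactly in the rows of the starting generators of \<open>s\<close>. Dually, if \<open>s\<close> has two starting
  and two finishing generators, then \<open>\<rho>\<^sub>4(s)\<^sup>-\<^sup>1\<close> turns any matrix attaining its highest level in the row of the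
  non-starting generator into one that attains it exactly in the row of the non-finishing generator.
  In both cases no cancellation can occur. The only proper simple braid covered by neither case is
  \<open>\<sigma>\<^sub>2\<sigma>\<^sub>1\<sigma>\<^sub>3\<close>.

  Without this factor the normal form is \<open>\<Delta>\<^sup>p P S\<close>, where all factors of \<open>P\<close> are of the second kind
  and all factors of \<open>S\<close> of the first. Triviality of \<open>\<rho>\<^sub>4(x)\<close> gives
  \<open>\<rho>\<^sub>4(S) = \<rho>\<^sub>4(P)\<^sup>-\<^sup>1 \<rho>\<^sub>4(\<Delta>)\<^sup>-\<^sup>p\<close>, but by left-weightedness the row of the right-hand side is not
  among the rows of the left-hand side.
\<close>

section \<open>Simple braids and their descents\<close>

abbreviation word_braid :: "artin list \<Rightarrow> braid4" where
  "word_braid w \<equiv> prod_list (map \<sigma> w)"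

lemma UNIV_artin: "UNIV = {S1, S2, S3}"
  using artin.exhaust by auto

instance artin :: finite
  by standard (simp add: UNIV_artin)

lemma all_artin: "(\<forall>i. P i) \<longleftrightarrow> P S1 \<and> P S2 \<and> P S3"
  by (metis artin.exhaust)

lemma sum_artin: "(\<Sum>i\<in>UNIV. f i) = f S1 + f S2 + f S3"
  for f :: "artin \<Rightarrow> 'a::comm_monoid_add"
  by (simp add: UNIV_artin add.assoc)

interpretation braid4: group "(*)" "1 :: braid4" inverse
  by (rule group_braid4)

text \<open>The non-quadratic rules of the complete rewriting system for the Coxeter presentation of the
  symmetric group on four letters; they bring every reduced word into normal form.\<close>

lemma braid_rewrite:
  "\<sigma> S3 * \<sigma> S1 = \<sigma> S1 * \<sigma> S3"
  "\<sigma> S2 * (\<sigma> S1 * \<sigma> S2) = \<sigma> S1 * (\<sigma> S2 * \<sigma> S1)"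
  "\<sigma> S3 * (\<sigma> S2 * \<sigma> S3) = \<sigma> S2 * (\<sigma> S3 * \<sigma> S2)"
  "\<sigma> S3 * (\<sigma> S2 * (\<sigma> S1 * \<sigma> S3)) = \<sigma> S2 * (\<sigma> S3 * (\<sigma> S2 * \<sigma> S1))"
  using artin_relations by (auto simp: mult.assoc) (metis mult.assoc)+

lemma braid_rewrite_assoc:
  "\<sigma> S3 * (\<sigma> S1 * x) = \<sigma> S1 * (\<sigma> S3 * x)"
  "\<sigma> S2 * (\<sigma> S1 * (\<sigma> S2 * x)) = \<sigma> S1 * (\<sigma> S2 * (\<sigma> S1 * x))"
  "\<sigma> S3 * (\<sigma> S2 * (\<sigma> S3 * x)) = \<sigma> S2 * (\<sigma> S3 * (\<sigma> S2 * x))"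
  "\<sigma> S3 * (\<sigma> S2 * (\<sigma> S1 * (\<sigma> S3 * x))) = \<sigma> S2 * (\<sigma> S3 * (\<sigma> S2 * (\<sigma> S1 * x)))"
  using braid_rewrite by (metis mult.assoc)+

lemmas braid_simps = mult.assoc braid_rewrite braid_rewrite_assoc

section \<open>Length and permutation invariants of braids\<close>

lift_definition exponent_sum :: "braid4 \<Rightarrow> int" is
  "\<lambda>w. \<Sum>(i, b) \<leftarrow> w. if b then 1 else -1"
proof -
  fix u v assume "braid_eq u v"
  then show "(\<Sum>(i, b) \<leftarrow> u. if b then 1 else - 1 :: int) = (\<Sum>(i, b) \<leftarrow> v. if b then 1 else -1)"
    by induction (auto elim: braid_rel.cases)
qed

lemma exponent_sum_1 [simp]: "exponent_sum 1 = 0"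
  by transfer simp

lemma exponent_sum_mult [simp]: "exponent_sum (x * y) = exponent_sum x + exponent_sum y"
  by transfer simp

lemma exponent_sum_gen [simp]: "exponent_sum (\<sigma> i) = 1"
  by transfer simp

lemma exponent_sum_word [simp]: "exponent_sum (word_braid w) = int (length w)"
  by (induction w) auto

fun swap :: "artin \<Rightarrow> nat \<times> nat \<times> nat \<times> nat \<Rightarrow> nat \<times> nat \<times> nat \<times> nat" where
  "swap S1 (a, b, c, d) = (b, a, c, d)"
| "swap S2 (a, b, c, d) = (a, c, b, d)"
| "swap S3 (a, b, c, d) = (a, b, d, c)"

lemma swap_swap [simp]: "swap i (swap i t) = t"
  by (cases "(i, t)" rule: swap.cases) auto

fun inversions :: "nat \<times> nat \<times> nat \<times> nat \<Rightarrow> nat" where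
  "inversions (a, b, c, d) = of_bool (a > b) + of_bool (a > c) + of_bool (a > d) +
     of_bool (b > c) + of_bool (b > d) + of_bool (c > d)"

lemma inversions_swap: "inversions (swap i t) \<le> Suc (inversions t)"
  by (cases "(i, t)" rule: swap.cases) auto

lemma swap_braid:
  "swap S1 (swap S2 (swap S1 t)) = swap S2 (swap S1 (swap S2 t))"
  "swap S2 (swap S3 (swap S2 t)) = swap S3 (swap S2 (swap S3 t))"
  "swap S1 (swap S3 t) = swap S3 (swap S1 t)"
  by (cases t; simp)+

text \<open>Braids act through the symmetric group by adjacent swaps; the inversions of the image of
  \<open>(0, 1, 2, 3)\<close> give the Coxeter length.\<close>

lift_definition permute :: "braid4 \<Rightarrow> nat \<times> nat \<times> nat \<times> nat \<Rightarrow> nat \<times> nat \<times> nat \<times> nat" is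
  "\<lambda>w. fold (\<lambda>(i, b). swap i) w"
proof -
  fix u v :: braid_word assume "braid_eq u v"
  then show "fold (\<lambda>(i, b). swap i) u = fold (\<lambda>(i, b). swap i) v"
    by induction (auto elim!: braid_rel.cases simp: swap_braid fun_eq_iff)
qed

lemma permute_1 [simp]: "permute 1 t = t"
  by transfer simp

lemma permute_mult [simp]: "permute (x * y) t = permute y (permute x t)"
  by transfer simp

lemma permute_gen [simp]: "permute (\<sigma> i) = swap i"
  by transfer simp

lemma inversions_permute_word:
  "inversions (permute (word_braid w) t) \<le> inversions t + length w"
proof (induction w arbitrary: t)
  case (Cons i w)
  have "inversions (permute (word_braid w) (swap i t)) \<le> inversions (swap i t) + length w"
    by (rule Cons)
  with inversions_swap[of i t] show ?case by simp
qed auto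

text \<open>Each simple braid, as a normal form word, with its sets of starting and finishing generators.\<close>

definition simple_table :: "(artin list \<times> artin set \<times> artin set) list" where
  "simple_table = [
     ([], {}, {}),
     ([S3], {S3}, {S3}),
     ([S3, S2], {S3}, {S2}),
     ([S3, S2, S1], {S3}, {S1}),
     ([S2], {S2}, {S2}),
     ([S2, S3], {S2}, {S3}),
     ([S2, S3, S2], {S2, S3}, {S2, S3}),
     ([S2, S3, S2, S1], {S2, S3}, {S1, S3}),
     ([S2, S1], {S2}, {S1}),
     ([S2, S1, S3], {S2}, {S1, S3}),
     ([S2, S1, S3, S2], {S2}, {S2}),
     ([S2, S1, S3, S2, S1], {S2, S3}, {S1, S2}),
     ([S1], {S1}, {S1}),
     ([S1, S3], {S1, S3}, {S1, S3}),
     ([S1, S3, S2], {S1, S3}, {S2}),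
     ([S1, S3, S2, S1], {S1, S3}, {S1, S2}),
     ([S1, S2], {S1}, {S2}),
     ([S1, S2, S3], {S1}, {S3}),
     ([S1, S2, S3, S2], {S1, S3}, {S2, S3}),
     ([S1, S2, S3, S2, S1], {S1, S3}, {S1, S3}),
     ([S1, S2, S1], {S1, S2}, {S1, S2}),
     ([S1, S2, S1, S3], {S1, S2}, {S1, S3}),
     ([S1, S2, S1, S3, S2], {S1, S2}, {S2, S3}),
     ([S1, S2, S1, S3, S2, S1], {S1, S2, S3}, {S1, S2, S3})]"

text \<open>The inversion count discards the steps that would produce a square; every other product
  is brought to a table word by braid relations alone.\<close>

lemma simple_table_step:
  "\<forall>(w, L, R) \<in> set simple_table. \<forall>i.
     inversions (permute (word_braid w * \<sigma> i) (0, 1, 2, 3)) = Suc (length w) \<longrightarrow>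
     (\<exists>(w', L', R') \<in> set simple_table. length w' = Suc (length w) \<and> word_braid w * \<sigma> i = word_braid w')"
  unfolding all_artin
  by (simp add: simple_table_def braid_simps)

text \<open>Each letter creates at most one inversion, so prefixes of a reduced word are reduced and
  the word can be followed through the table letter by letter.\<close>

lemma reduced_word_simple_table:
  assumes "inversions (permute (word_braid w) (0, 1, 2, 3)) = length w"
  shows "\<exists>(w', L, R) \<in> set simple_table. length w' = length w \<and> word_braid w = word_braid w'"
  using assms
proof (induction w rule: rev_induct)
  case Nil
  then show ?case by (auto simp: simple_table_def)
next
  case (snoc i w)
  have "inversions (permute (word_braid w) (0, 1, 2, 3)) \<le> length w"
    using inversions_permute_word[of w "(0, 1, 2, 3)"] by simp
  moreover have "Suc (length w) \<le> Suc (inversions (permute (word_braid w) (0, 1, 2, 3)))"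
    using snoc.prems inversions_swap[of i "permute (word_braid w) (0, 1, 2, 3)"] by simp
  ultimately obtain w' L R where w': "(w', L, R) \<in> set simple_table" "length w' = length w"
      "word_braid w = word_braid w'"
    using snoc.IH by fastforce
  with snoc.prems have "inversions (permute (word_braid w' * \<sigma> i) (0, 1, 2, 3)) = Suc (length w')"
    by simp
  with simple_table_step w' show ?case by fastforce
qed

text \<open>If \<open>s\<close> times a positive braid is \<Delta>, the two lengths add up to 6, the
  inversion number of \<Delta>. Hence every letter must create an inversion, which makes the word
  for \<open>s\<close> reduced.\<close>

lemma simple_braid_in_table:
  assumes "s \<in> simple_braids"
  obtains w L R where "(w, L, R) \<in> set simple_table" "s = word_braid w"
proof -
  from assms obtain w u where w: "s = word_braid w" and u: "inverse s * \<Delta> = word_braid u"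
    by (auto simp: simple_braids_def prefix_le_def positive_braids_def)
  have \<Delta>: "\<Delta> = word_braid w * word_braid u"
    by (simp add: braid4.left_cancel mult.assoc[symmetric] flip: w u)
  from arg_cong[OF this, of exponent_sum] have "length w + length u = 6"
    by (simp add: Garside_def)
  moreover from arg_cong[OF \<Delta>, of "\<lambda>x. inversions (permute x (0, 1, 2, 3))"]
  have "6 = inversions (permute (word_braid u) (permute (word_braid w) (0, 1, 2, 3)))"
    by (simp add: Garside_def)
  ultimately have "inversions (permute (word_braid w) (0, 1, 2, 3)) = length w"
    using inversions_permute_word[of w "(0, 1, 2, 3)"]
      inversions_permute_word[of u "permute (word_braid w) (0, 1, 2, 3)"] by simp
  from reduced_word_simple_table[OF this] w that show thesis by auto
qed


lemma simple_table_descents: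
  "\<forall>(w, L, R) \<in> set simple_table.
     (\<forall>i\<in>L. \<exists>(u, _) \<in> set simple_table. word_braid w = \<sigma> i * word_braid u) \<and>
     (\<forall>i. i \<notin> R \<longrightarrow> (\<exists>(u, _) \<in> set simple_table. word_braid w * \<sigma> i * word_braid u = \<Delta>))"
  unfolding all_artin Garside_def
  by (simp add: simple_table_def braid_simps)

lemma exponent_sum_inverse [simp]: "exponent_sum (inverse x) = - exponent_sum x"
  using exponent_sum_mult[of x "inverse x"] by simp

lemma exponent_sum_positive: "x \<in> positive_braids \<Longrightarrow> exponent_sum x \<ge> 0"
  by (auto simp: positive_braids_def)

lemma inverse_mult_braid: "inverse (x * y) = inverse y * inverse (x :: braid4)"
  by (rule braid4.inverse_distrib_swap)

lemma braid_cancel [simp]: "inverse x * (x * y) = (y :: braid4)" "x * (inverse x * y) = (y :: braid4)"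
  by (simp_all flip: mult.assoc)

text \<open>A starting generator of the second factor that does not finish the first could be moved
  into the first, giving a longer common divisor than the meet.\<close>

lemma left_weighted_descents:
  assumes "left_weighted (word_braid w) (word_braid w')"
    and w: "(w, L, R) \<in> set simple_table" and w': "(w', L', R') \<in> set simple_table"
  shows "L' \<subseteq> R"
proof
  fix i assume "i \<in> L'"
  then obtain d where d: "word_braid w' = \<sigma> i * word_braid d"
    using simple_table_descents w' by fastforce
  show "i \<in> R"
  proof (rule ccontr)
    assume "i \<notin> R"
    then obtain u where u: "word_braid w * \<sigma> i * word_braid u = \<Delta>"
      using simple_table_descents w by fastforce
    have "word_braid w * \<sigma> i \<preceq>\<^sub>c \<Delta>"
      by (auto simp: prefix_le_def positive_braids_def inverse_mult_braid mult.assoc simp flip: u)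
    moreover have "word_braid w * \<sigma> i \<preceq>\<^sub>c word_braid w * word_braid w'"
      by (auto simp: prefix_le_def positive_braids_def inverse_mult_braid mult.assoc d)
    ultimately have "word_braid w * \<sigma> i \<preceq>\<^sub>c word_braid w"
      using assms(1) by (auto simp: left_weighted_def is_meet_def)
    then have "inverse (\<sigma> i) \<in> positive_braids"
      by (simp add: prefix_le_def inverse_mult_braid mult.assoc)
    from exponent_sum_positive[OF this] show False by simp
  qed
qed

section \<open>The rows of highest level\<close>

fun position :: "artin \<Rightarrow> int" where
  "position S1 = 1" | "position S2 = 2" | "position S3 = 3"

fun index :: "artin \<Rightarrow> 3" where
  "index S1 = 1" | "index S2 = 2" | "index S3 = 3"

definition entry_coeff :: "laurent ^ 3 ^ 3 \<Rightarrow> artin \<Rightarrow> artin \<Rightarrow> int \<Rightarrow> int" where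
  "entry_coeff M i k e = Poly_Mapping.lookup (M $ index i $ index k) e"

definition level :: "artin \<Rightarrow> artin \<Rightarrow> int \<Rightarrow> int" where
  "level i k e = 2 * e + position i - position k"

lemma level_add: "level i k (a + b) = level i j a + level j k b"
  by (simp add: level_def)

text \<open>With empty \<open>X\<close> the bound \<open>m\<close> is strict, so only nonempty sets
  pin down the highest level.\<close>

definition top_rows :: "laurent ^ 3 ^ 3 \<Rightarrow> int \<Rightarrow> artin set \<Rightarrow> bool" where
  "top_rows M m X \<longleftrightarrow>
     (\<forall>i k e. entry_coeff M i k e \<noteq> 0 \<longrightarrow> level i k e \<le> m) \<and>
     (\<forall>i. i \<in> X \<longleftrightarrow> (\<exists>k e. entry_coeff M i k e \<noteq> 0 \<and> level i k e = m))"

text \<open>Every row in \<open>Y\<close> attains the top level \<open>c\<close> of \<open>A\<close> in exactly one column, given by \<open>f\<close>, which is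
  what excludes cancellation of top terms in a product \<open>A ** M\<close>.\<close>

definition dominated :: "laurent ^ 3 ^ 3 \<Rightarrow> int \<Rightarrow> (artin \<Rightarrow> artin) \<Rightarrow> artin set \<Rightarrow> bool" where
  "dominated A c f Y \<longleftrightarrow>
     (\<forall>i\<in>Y. \<exists>e. entry_coeff A i (f i) e \<noteq> 0 \<and> level i (f i) e = c) \<and>
     (\<forall>i k e. entry_coeff A i k e \<noteq> 0 \<longrightarrow> level i k e \<le> (if i \<in> Y \<and> k = f i then c else c - 1))"

lemma dominated_level_le:
  assumes "dominated A c f Y" "entry_coeff A i k e \<noteq> 0"
  shows "level i k e \<le> (if i \<in> Y \<and> k = f i then c else c - 1)"
  using assms unfolding dominated_def by blast

lemma top_rows_level_le: "top_rows M m X \<Longrightarrow> entry_coeff M i k e \<noteq> 0 \<Longrightarrow> level i k e \<le> m"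
  unfolding top_rows_def by blast

section \<open>Leading coefficients of products\<close>

lemma lookup_mult_nonzero:
  fixes f g :: laurent
  assumes "Poly_Mapping.lookup (f * g) e \<noteq> 0"
  obtains a b where "e = a + b" "Poly_Mapping.lookup f a \<noteq> 0" "Poly_Mapping.lookup g b \<noteq> 0"
proof -
  have "e \<in> Poly_Mapping.keys (f * g)"
    using assms by (simp add: in_keys_iff)
  with keys_mult[of f g] that show thesis
    by (auto simp: in_keys_iff)
qed

text \<open>Once the monomials at the bounds are removed, the remainders have degrees strictly below
  \<open>a\<close> and \<open>b\<close>, so only the product of these monomials reaches
  \<open>a + b\<close>.\<close>

lemma lookup_mult_top:
  fixes f g :: laurent
  assumes f: "\<And>x. Poly_Mapping.lookup f x \<noteq> 0 \<Longrightarrow> x \<le> a"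
    and g: "\<And>x. Poly_Mapping.lookup g x \<noteq> 0 \<Longrightarrow> x \<le> b"
  shows "Poly_Mapping.lookup (f * g) (a + b) = Poly_Mapping.lookup f a * Poly_Mapping.lookup g b"
proof -
  define f' where "f' = f - Poly_Mapping.single a (Poly_Mapping.lookup f a)"
  define g' where "g' = g - Poly_Mapping.single b (Poly_Mapping.lookup g b)"
  have f': "x < a" if "Poly_Mapping.lookup f' x \<noteq> 0" for x
    using that f[of x] by (auto simp: f'_def lookup_minus lookup_single when_def split: if_splits)
  have g': "x < b" if "Poly_Mapping.lookup g' x \<noteq> 0" for x
    using that g[of x] by (auto simp: g'_def lookup_minus lookup_single when_def split: if_splits)
  have 1: "Poly_Mapping.lookup (f' * g) (a + b) = 0"
    using f' g by (metis add_less_le_mono less_irrefl lookup_mult_nonzero)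
  have 2: "Poly_Mapping.lookup (Poly_Mapping.single a (Poly_Mapping.lookup f a) * g') (a + b) = 0"
  proof (rule ccontr)
    assume "\<not> ?thesis"
    then obtain x y where "a + b = x + y" "Poly_Mapping.lookup g' y \<noteq> 0"
        "Poly_Mapping.lookup (Poly_Mapping.single a (Poly_Mapping.lookup f a)) x \<noteq> 0"
      by (rule lookup_mult_nonzero)
    with g'[of y] show False by (auto simp: lookup_single when_def split: if_splits)
  qed
  have "f * g = f' * g + Poly_Mapping.single a (Poly_Mapping.lookup f a) * g' +
      Poly_Mapping.single (a + b) (Poly_Mapping.lookup f a * Poly_Mapping.lookup g b)"
    by (simp add: f'_def g'_def algebra_simps flip: Poly_Mapping.mult_single)
  with 1 2 show ?thesis
    by (simp add: lookup_add)
qed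

lemma entry_coeff_mult:
  "entry_coeff (A ** B) i k e = (\<Sum>j\<in>UNIV. Poly_Mapping.lookup ((A $ index i $ index j) * (B $ index j $ index k)) e)"
  by (simp add: entry_coeff_def matrix_matrix_mult_def sum_3 sum_artin lookup_add)

text \<open>Levels add along products. In a row \<open>i\<close> of \<open>Y\<close> only the
  summand through column \<open>f i\<close> can reach \<open>c + m\<close>, and there its
  coefficient is a product of two nonzero integers.\<close>

lemma top_rows_mult:
  assumes M: "top_rows M m X" and A: "dominated A c f Y" and f: "f ` Y \<subseteq> X"
  shows "top_rows (A ** M) (c + m) Y"
proof -
  have summand: "\<exists>a b. e = a + b \<and> entry_coeff A i j a \<noteq> 0 \<and> entry_coeff M j k b \<noteq> 0 \<and>
      level i k e \<le> (if i \<in> Y \<and> j = f i then c else c - 1) + m"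
    if "Poly_Mapping.lookup ((A $ index i $ index j) * (M $ index j $ index k)) e \<noteq> 0" for i j k e
  proof -
    from that obtain a b where "e = a + b" "entry_coeff A i j a \<noteq> 0" "entry_coeff M j k b \<noteq> 0"
      unfolding entry_coeff_def by (rule lookup_mult_nonzero)
    moreover from this have "level i j a \<le> (if i \<in> Y \<and> j = f i then c else c - 1)" "level j k b \<le> m"
      using dominated_level_le[OF A] top_rows_level_le[OF M] by blast+
    ultimately show ?thesis
      using level_add[of i k a b j] by force
  qed
  have bound: "level i k e \<le> (if i \<in> Y then c else c - 1) + m" if "entry_coeff (A ** M) i k e \<noteq> 0" for i k e
  proof -
    from that obtain j where
      "Poly_Mapping.lookup ((A $ index i $ index j) * (M $ index j $ index k)) e \<noteq> 0"
      unfolding entry_coeff_mult by (meson sum.neutral)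
    from summand[OF this] show ?thesis by (auto split: if_splits)
  qed
  have attained: "\<exists>k e. entry_coeff (A ** M) i k e \<noteq> 0 \<and> level i k e = c + m" if i: "i \<in> Y" for i
  proof -
    obtain a where a: "entry_coeff A i (f i) a \<noteq> 0" "level i (f i) a = c"
      using A i by (auto simp: dominated_def)
    \<comment> \<open>Row \<open>f i\<close> of \<open>M\<close> attains level \<open>m\<close>
      because \<open>f\<close> maps into \<open>X\<close>; the same column \<open>k\<close> serves
      the product.\<close>
    obtain k b where b: "entry_coeff M (f i) k b \<noteq> 0" "level (f i) k b = m"
      using M f i by (force simp: top_rows_def)
    have lev: "level i k (a + b) = c + m"
      using a b level_add[of i k a b "f i"] by simp
    have "entry_coeff (A ** M) i k (a + b) =
        (\<Sum>j\<in>UNIV. if j = f i then entry_coeff A i j a * entry_coeff M j k b else 0)"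
      unfolding entry_coeff_mult
    proof (rule sum.cong)
      fix j :: artin
      show "Poly_Mapping.lookup ((A $ index i $ index j) * (M $ index j $ index k)) (a + b) =
          (if j = f i then entry_coeff A i j a * entry_coeff M j k b else 0)"
      proof (cases "j = f i")
        case False
        then show ?thesis using summand[of i j k "a + b"] lev by force
      next
        case True
        have "x \<le> a" if x: "entry_coeff A i j x \<noteq> 0" for x
        proof -
          have "level i j x \<le> c"
            using dominated_level_le[OF A x] by (simp split: if_splits)
          then show ?thesis using a True by (simp add: level_def)
        qed
        moreover have "x \<le> b" if x: "entry_coeff M j k x \<noteq> 0" for x
        proof -
          have "level j k x \<le> m"
            by (rule top_rows_level_le[OF M x])
          then show ?thesis using b True by (simp add: level_def)
        qed
        ultimately show ?thesis
          using True lookup_mult_top[of "A $ index i $ index j" a "M $ index j $ index k" b]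
          by (simp add: entry_coeff_def)
      qed
    qed simp
    also have "\<dots> \<noteq> 0"
      using a b by simp
    finally show ?thesis using lev by blast
  qed
  have "level i k e \<le> c + m" if "entry_coeff (A ** M) i k e \<noteq> 0" for i k e
    using bound[OF that] by (auto split: if_splits)
  moreover have "i \<in> Y" if "entry_coeff (A ** M) i k e \<noteq> 0" "level i k e = c + m" for i k e
    using bound[OF that(1)] that(2) by (auto split: if_splits)
  ultimately show ?thesis
    using attained unfolding top_rows_def by blast
qed

lemma top_rows_mat_1: "top_rows (mat 1) 0 UNIV"
proof -
  have 1: "(1 :: laurent) = Poly_Mapping.single 0 1"
    by simp
  have "entry_coeff (mat 1) i k e = (1 when i = k \<and> e = 0)" for i k e
    by (cases i; cases k) (auto simp: entry_coeff_def mat_def 1 lookup_single when_def simp del: single_one)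
  then show ?thesis
    by (auto simp: top_rows_def level_def when_def)
qed

lemma top_rows_unique:
  assumes "top_rows M m X" "top_rows M n Y" "X \<noteq> {}" "Y \<noteq> {}"
  shows "m = n" "X = Y"
proof -
  show "m = n"
    using assms unfolding top_rows_def by (metis antisym ex_in_conv)
  with assms show "X = Y"
    unfolding top_rows_def by blast
qed

section \<open>Matrices of simple braids\<close>

lemma vector_3_mult:
  "(vector [vector [a, b, c], vector [d, e, f], vector [g, h, i]] :: 'a::semiring_1 ^ 3 ^ 3) **
     (vector [vector [a', b', c'], vector [d', e', f'], vector [g', h', i']] :: 'a ^ 3 ^ 3) =
   vector [vector [a * a' + b * d' + c * g', a * b' + b * e' + c * h', a * c' + b * f' + c * i'],
     vector [d * a' + e * d' + f * g', d * b' + e * e' + f * h', d * c' + e * f' + f * i'],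
     vector [g * a' + h * d' + i * g', g * b' + h * e' + i * h', g * c' + h * f' + i * i']]"
  unfolding vec_eq_iff forall_3 by (simp add: matrix_matrix_mult_def sum_3)

lemma mat_1_vector_3: "(mat 1 :: 'a::semiring_1 ^ 3 ^ 3) = vector [vector [1, 0, 0], vector [0, 1, 0], vector [0, 0, 1]]"
  unfolding vec_eq_iff forall_3 by (simp add: mat_def)

lemma burau4_inverse_gen: "burau4 (inverse (\<sigma> i)) = burau_gen_inv i"
  by transfer simp

lemma lookup_1_laurent: "Poly_Mapping.lookup (1 :: laurent) e = (1 when e = 0)"
  by (metis lookup_single single_one when_def)

text \<open>Solves \<open>level i (f i) e = c\<close> for \<open>e\<close>, at the cost of a parity
  condition, so that the existential becomes a test of one coefficient.\<close>

lemma dominated_iff: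
  "dominated A c f Y \<longleftrightarrow>
     (\<forall>i. i \<in> Y \<longrightarrow> even (c + position (f i) - position i) \<and>
        entry_coeff A i (f i) ((c + position (f i) - position i) div 2) \<noteq> 0) \<and>
     (\<forall>i k e. entry_coeff A i k e \<noteq> 0 \<longrightarrow> level i k e \<le> (if i \<in> Y \<and> k = f i then c else c - 1))"
proof -
  have "(\<exists>e. entry_coeff A i (f i) e \<noteq> 0 \<and> level i (f i) e = c) \<longleftrightarrow>
      even (c + position (f i) - position i) \<and>
        entry_coeff A i (f i) ((c + position (f i) - position i) div 2) \<noteq> 0" for i
  proof -
    have "level i (f i) e = c \<longleftrightarrow> even (c + position (f i) - position i) \<and> e = (c + position (f i) - position i) div 2" for e
      unfolding level_def by presburger
    then show ?thesis by auto
  qed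
  then show ?thesis by (simp add: dominated_def Ball_def)
qed

lemmas burau_eval = burau4_mult burau4_one burau4_generator burau4_inverse_gen inverse_mult_braid
  vector_3_mult mat_1_vector_3

lemmas dominated_eval = dominated_iff all_artin entry_coeff_def level_def lookup_add lookup_1_laurent lookup_single when_def

text \<open>Entries \<open>(w, j, c, L)\<close>: the word has the single finishing generator \<open>j\<close> and the starting
  generators \<open>L\<close>, and left multiplication by its matrix raises the top level by \<open>c\<close>.\<close>

definition single_steps :: "(artin list \<times> artin \<times> int \<times> artin set) list" where
  "single_steps = [
     ([S3], S3, 2, {S3}),
     ([S3, S2], S2, 3, {S3}),
     ([S3, S2, S1], S1, 4, {S3}),
     ([S2], S2, 2, {S2}),
     ([S2, S3], S3, 3, {S2}),
     ([S2, S1], S1, 3, {S2}),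
     ([S2, S1, S3, S2], S2, 4, {S2}),
     ([S1], S1, 2, {S1}),
     ([S1, S3, S2], S2, 3, {S1, S3}),
     ([S1, S2], S2, 3, {S1}),
     ([S1, S2, S3], S3, 4, {S1})]"

text \<open>Entries \<open>(w, j, c, R)\<close>: \<open>j\<close> is the only non-starting generator, \<open>R\<close> consists of the two finishing
  generators, and left multiplication by the inverse matrix raises the top level by \<open>c\<close>.\<close>

definition double_steps :: "(artin list \<times> artin \<times> int \<times> artin set) list" where
  "double_steps = [
     ([S2, S3, S2], S1, 0, {S2, S3}),
     ([S2, S3, S2, S1], S1, -1, {S1, S3}),
     ([S2, S1, S3, S2, S1], S1, -2, {S1, S2}),
     ([S1, S3], S2, 0, {S1, S3}),
     ([S1, S3, S2, S1], S2, -1, {S1, S2}),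
     ([S1, S2, S3, S2], S2, -1, {S2, S3}),
     ([S1, S2, S3, S2, S1], S2, -2, {S1, S3}),
     ([S1, S2, S1], S3, 0, {S1, S2}),
     ([S1, S2, S1, S3], S3, -1, {S1, S3}),
     ([S1, S2, S1, S3, S2], S3, -2, {S2, S3})]"

lemma dominated_single:
  "\<forall>(w, j, c, L) \<in> set single_steps. dominated (burau4 (word_braid w)) c (\<lambda>_. j) L"
  by (simp add: single_steps_def burau_eval algebra_simps)
    (simp add: dominated_eval q_def q_inv_def Poly_Mapping.mult_single lookup_minus)

lemma dominated_double:
  "\<forall>(w, j, c, R) \<in> set double_steps. dominated (burau4 (inverse (word_braid w))) c (\<lambda>_. j) (- R)"
  by (simp add: double_steps_def burau_eval algebra_simps)
    (simp add: dominated_eval q_def q_inv_def Poly_Mapping.mult_single lookup_minus)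

text \<open>The matrix of \<Delta> is antidiagonal; the column map is the flip that conjugation by
  \<Delta> induces on the generators.\<close>

lemma dominated_Garside:
  "dominated (burau4 \<Delta>) 4 (case_artin S3 S2 S1) UNIV"
  "dominated (burau4 (inverse \<Delta>)) (-4) (case_artin S3 S2 S1) UNIV"
  by (simp_all add: Garside_def burau_eval algebra_simps)
    (simp_all add: dominated_eval q_def q_inv_def Poly_Mapping.mult_single lookup_minus)

definition proper_factor :: "artin list \<times> artin set \<times> artin set \<Rightarrow> bool" where
  "proper_factor e \<longleftrightarrow> e \<in> set simple_table \<and>
     word_braid (fst e) \<notin> {1, \<Delta>, \<sigma> S2 * \<sigma> S1 * \<sigma> S3}"

text \<open>Apart from the three exceptions, 11 entries have one finishing generator and the other
  10 have two starting and two finishing generators.\<close>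

lemma simple_table_steps:
  "\<forall>(w, L, R) \<in> set simple_table.
     word_braid w \<in> {1, \<Delta>, \<sigma> S2 * \<sigma> S1 * \<sigma> S3} \<or>
     (\<exists>j c. R = {j} \<and> L \<noteq> {} \<and> L \<noteq> UNIV \<and> (w, j, c, L) \<in> set single_steps) \<or>
     (\<exists>j c. L = - {j} \<and> R \<noteq> {} \<and> R \<noteq> UNIV \<and> (\<forall>i. R \<noteq> {i}) \<and> (w, j, c, R) \<in> set double_steps)"
  unfolding simple_table_def single_steps_def double_steps_def Garside_def
  by (simp add: braid_simps) (auto simp: UNIV_artin intro: artin.exhaust)

lemma proper_factor_cases:
  assumes "proper_factor (w, L, R)"
  obtains (single) j c where "R = {j}" "L \<noteq> {}" "L \<noteq> UNIV"
      "dominated (burau4 (word_braid w)) c (\<lambda>_. j) L"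
    | (double) j c where "L = - {j}" "R \<noteq> {}" "R \<noteq> UNIV" "\<And>i. R \<noteq> {i}"
      "dominated (burau4 (inverse (word_braid w))) c (\<lambda>_. j) (- R)"
proof -
  have "(\<exists>j c. R = {j} \<and> L \<noteq> {} \<and> L \<noteq> UNIV \<and> (w, j, c, L) \<in> set single_steps) \<or>
     (\<exists>j c. L = - {j} \<and> R \<noteq> {} \<and> R \<noteq> UNIV \<and> (\<forall>i. R \<noteq> {i}) \<and> (w, j, c, R) \<in> set double_steps)"
    using assms simple_table_steps unfolding proper_factor_def by fastforce
  then show thesis
    using that dominated_single dominated_double by fast
qed

section \<open>Normal forms\<close>

text \<open>A single finishing generator \<open>j\<close> forces the next factor to start with
  \<open>{j}\<close> only, which excludes the double kind. So all later factors are single, and the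
  top rows are computed from the right end.\<close>

lemma top_rows_single_chain:
  assumes "\<forall>e\<in>set ((w, L, {j}) # es). proper_factor e"
    and "successively (\<lambda>e e'. fst (snd e') \<subseteq> snd (snd e)) ((w, L, {j}) # es)"
  shows "\<exists>m. top_rows (burau4 (word_braid (concat (map fst ((w, L, {j}) # es))))) m L"
  using assms
proof (induction es arbitrary: w L j)
  case Nil
  then have "proper_factor (w, L, {j})" by simp
  then show ?case
  proof (cases rule: proper_factor_cases)
    case (single j' c)
    \<comment> \<open>The identity attains its highest level in every row, in particular in row
      \<open>j\<close>.\<close>
    then have "top_rows (burau4 (word_braid w) ** mat 1) (c + 0) L"
      by (intro top_rows_mult[OF top_rows_mat_1]) auto
    then show ?thesis by auto
  next
    case double
    then show ?thesis by blast
  qed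
next
  case (Cons e es)
  obtain w' L' R' where e: "e = (w', L', R')" by (cases e) auto
  have proper: "proper_factor (w, L, {j})" "proper_factor (w', L', R')" and L': "L' \<subseteq> {j}"
    using Cons.prems by (auto simp: e)
  from proper(2) obtain j' where R': "R' = {j'}" and "L' \<noteq> {}"
  proof (cases rule: proper_factor_cases)
    case (double j')
    with L' show ?thesis by (cases j; cases j') auto
  qed auto
  with L' have "L' = {j}" by blast
  with Cons.IH[of w' L' j'] Cons.prems obtain m where
    m: "top_rows (burau4 (word_braid (concat (map fst (e # es))))) m {j}"
    by (auto simp: e R')
  from proper(1) show ?case
  proof (cases rule: proper_factor_cases)
    case (single j'' c)
    then have "top_rows (burau4 (word_braid w) ** burau4 (word_braid (concat (map fst (e # es))))) (c + m) L"
      by (intro top_rows_mult[OF m]) auto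
    then show ?thesis by (auto simp: burau4_mult)
  next
    case double
    then show ?thesis by blast
  qed
qed

text \<open>\<open>N\<close> is arbitrary so that a leading double factor can be cancelled by moving
  its inverse to the other side. \<open>X\<close> is \<open>UNIV\<close> before the first move and
  afterwards the complement of the finishing set just cancelled.\<close>

lemma burau4_chain_neq:
  assumes "\<forall>e\<in>set es. proper_factor e"
    and "successively (\<lambda>e e'. fst (snd e') \<subseteq> snd (snd e)) es"
    and "top_rows N m X" "X \<noteq> {}"
    and "if es = [] then X \<noteq> UNIV else X = UNIV \<or> X \<inter> fst (snd (hd es)) = {}"
  shows "burau4 (word_braid (concat (map fst es))) \<noteq> N"
  using assms
proof (induction es arbitrary: N m X)
  case Nil
  have "N \<noteq> mat 1"
    using top_rows_unique(2)[OF top_rows_mat_1] Nil.prems(3-5) by force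
  then show ?case by (simp add: burau4_one)
next
  case (Cons e es)
  obtain w L R where e: "e = (w, L, R)" by (cases e) auto
  have "proper_factor (w, L, R)"
    using Cons.prems(1) by (simp add: e)
  then show ?case
  proof (cases rule: proper_factor_cases)
    case (single j c)
    with top_rows_single_chain[of w L j es] Cons.prems(1,2) obtain m' where
      "top_rows (burau4 (word_braid (concat (map fst (e # es))))) m' L"
      by (auto simp: e)
    \<comment> \<open>\<open>L\<close> is nonempty and proper, so it differs from
      \<open>UNIV\<close> and from any set disjoint from it.\<close>
    moreover have "X \<noteq> L"
      using single(2,3) Cons.prems(5) by (auto simp: e)
    ultimately show ?thesis
      using top_rows_unique(2) Cons.prems(3,4) single(2) by blast
  next
    case (double j c)
    \<comment> \<open>\<open>X\<close> is nonempty and, unless it is \<open>UNIV\<close>, avoids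
      \<open>L = - {j}\<close>.\<close>
    have "j \<in> X"
      using Cons.prems(4,5) double(1) by (auto simp: e)
    then have "top_rows (burau4 (inverse (word_braid w)) ** N) (c + m) (- R)"
      using double by (intro top_rows_mult[OF Cons.prems(3)]) auto
    \<comment> \<open>The next factor starts within \<open>R\<close>, hence avoids the new set
      \<open>- R\<close>.\<close>
    moreover have "if es = [] then - R \<noteq> UNIV else - R = UNIV \<or> - R \<inter> fst (snd (hd es)) = {}"
      using Cons.prems(2) double(2) by (cases es) (auto simp: e)
    ultimately have "burau4 (word_braid (concat (map fst es))) \<noteq> burau4 (inverse (word_braid w)) ** N"
      using Cons.prems(1,2) double(3) by (intro Cons.IH) (auto simp: successively_Cons)
    moreover have "burau4 (word_braid (concat (map fst es))) =
        burau4 (inverse (word_braid w)) ** burau4 (word_braid (concat (map fst (e # es))))"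
      by (simp add: e flip: burau4_mult)
    ultimately show ?thesis by auto
  qed
qed

lemma top_rows_Garside_power:
  "top_rows (burau4 (\<Delta> ^ n)) (4 * int n) UNIV"
  "top_rows (burau4 (inverse \<Delta> ^ n)) (- 4 * int n) UNIV"
proof (induction n)
  case (Suc n)
  show "top_rows (burau4 (\<Delta> ^ Suc n)) (4 * int (Suc n)) UNIV"
    "top_rows (burau4 (inverse \<Delta> ^ Suc n)) (- 4 * int (Suc n)) UNIV"
    using top_rows_mult[OF Suc(1) dominated_Garside(1)] top_rows_mult[OF Suc(2) dominated_Garside(2)]
    by (simp_all add: burau4_mult algebra_simps)
qed (use top_rows_mat_1 in \<open>simp_all add: burau4_one\<close>)

lemma inverse_power_braid: "inverse (x ^ n) = inverse (x :: braid4) ^ n"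
  by (induction n) (simp_all add: inverse_mult_braid flip: power_Suc2)

lemma top_rows_Garside_powi:
  "top_rows (burau4 (inverse (\<Delta> powi p))) (- 4 * p) UNIV"
  using top_rows_Garside_power[of "nat p"] top_rows_Garside_power[of "nat (- p)"]
  by (auto simp: power_int_def inverse_power_braid)

lemma simple_table_extremes:
  assumes "e \<in> set simple_table"
  shows "fst (snd e) = {} \<Longrightarrow> fst e = []" "snd (snd e) = UNIV \<Longrightarrow> word_braid (fst e) = \<Delta>"
    "fst e = [] \<Longrightarrow> snd (snd e) = {}" "length (fst e) = 6 \<Longrightarrow> fst (snd e) = UNIV"
proof -
  have "\<forall>(w, L, R) \<in> set simple_table.
     (L = {} \<longrightarrow> w = []) \<and> (R = UNIV \<longrightarrow> word_braid w = \<Delta>) \<and>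
     (w = [] \<longrightarrow> R = {}) \<and> (length w = 6 \<longrightarrow> L = UNIV)"
    by (simp add: simple_table_def Garside_def UNIV_artin braid_simps) auto
  with assms show "fst (snd e) = {} \<Longrightarrow> fst e = []" "snd (snd e) = UNIV \<Longrightarrow> word_braid (fst e) = \<Delta>"
    "fst e = [] \<Longrightarrow> snd (snd e) = {}" "length (fst e) = 6 \<Longrightarrow> fst (snd e) = UNIV"
    by (auto simp: case_prod_unfold)
qed

lemma successively_last:
  assumes "successively P xs" "x \<in> set xs" "Q x"
    and "\<And>y z. y \<in> set xs \<Longrightarrow> z \<in> set xs \<Longrightarrow> P y z \<Longrightarrow> Q y \<Longrightarrow> Q z"
  shows "Q (last xs)"
  using assms
proof (induction xs arbitrary: x)
  case (Cons y ys)
  show ?case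
  proof (cases ys)
    case ys: (Cons z zs)
    have "\<exists>x'\<in>set ys. Q x'"
      using Cons.prems ys by fastforce
    then obtain x' where "x' \<in> set ys" "Q x'" ..
    moreover have "successively P ys"
      using Cons.prems(1) by (cases ys) auto
    ultimately have "Q (last ys)"
      using Cons.IH[of x'] Cons.prems(4) by (meson list.set_intros(2))
    then show ?thesis using ys by simp
  qed (use Cons.prems in auto)
qed simp

lemma successively_hd:
  assumes "successively P xs" "x \<in> set xs" "Q x"
    and "\<And>y z. y \<in> set xs \<Longrightarrow> z \<in> set xs \<Longrightarrow> P y z \<Longrightarrow> Q z \<Longrightarrow> Q y"
  shows "Q (hd xs)"
  using successively_last[of "\<lambda>x y. P y x" "rev xs" x Q] assms
  by (simp add: last_rev successively_rev)

lemma word_braid_concat: "word_braid (concat ws) = prod_list (map word_braid ws)"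
  by (induction ws) simp_all

theorem theorem3p4:
  fixes x :: braid4 and p :: int and ss :: "braid4 list"
  assumes "x \<noteq> 1"
    and "left_normal_form x p ss"
    and "\<forall>s\<in>set ss. s \<noteq> \<sigma> S2 * \<sigma> S1 * \<sigma> S3"
  shows "burau4 x \<noteq> mat 1"
proof
  assume triv: "burau4 x = mat 1"
  have x: "x = \<Delta> powi p * prod_list ss" and simple: "set ss \<subseteq> simple_braids"
    and ends: "ss \<noteq> [] \<Longrightarrow> hd ss \<noteq> \<Delta> \<and> last ss \<noteq> 1"
    and weighted: "successively left_weighted ss"
    using assms(2) by (auto simp: left_normal_form_def successively_conv_nth)
  have "simple_braids \<subseteq> (\<lambda>e. word_braid (fst e)) ` set simple_table"
    by (force elim: simple_braid_in_table)
  with simple have "ss \<in> lists ((\<lambda>e. word_braid (fst e)) ` set simple_table)"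
    by auto
  then obtain es where table: "set es \<subseteq> set simple_table"
    and ss: "ss = map (\<lambda>e. word_braid (fst e)) es"
    unfolding lists_image by auto
  have succ: "successively (\<lambda>e e'. fst (snd e') \<subseteq> snd (snd e)) es"
    using weighted unfolding ss successively_map
    by (rule successively_mono) (use table left_weighted_descents in fastforce)
  have "word_braid (fst e) \<noteq> 1" if e: "e \<in> set es" for e
  proof
    assume "word_braid (fst e) = 1"
    from arg_cong[OF this, of exponent_sum] have "fst e = []" by simp
    \<comment> \<open>No generator may start the factor after a trivial one, so triviality spreads
      to the last factor, against \<open>ends\<close>.\<close>
    have "fst (last es) = []"
      using succ e \<open>fst e = []\<close>
    proof (rule successively_last)
      fix y z assume yz: "y \<in> set es" "z \<in> set es" "fst (snd z) \<subseteq> snd (snd y)" "fst y = []"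
      then have "snd (snd y) = {}"
        using table simple_table_extremes(3) by blast
      with yz table simple_table_extremes(1) show "fst z = []" by blast
    qed
    moreover have "es \<noteq> []"
      using e by auto
    with ends have "word_braid (fst (last es)) \<noteq> 1"
      by (simp add: ss last_map)
    ultimately show False by simp
  qed
  moreover have "word_braid (fst e) \<noteq> \<Delta>" if e: "e \<in> set es" for e
  proof
    assume \<Delta>: "word_braid (fst e) = \<Delta>"
    \<comment> \<open>A factor in front of \<Delta> is finished by all generators, hence is \<Delta>
      itself; this spreads back to the first factor.\<close>
    have "word_braid (fst (hd es)) = \<Delta>"
      using succ e \<Delta>
    proof (rule successively_hd)
      fix y z assume yz: "y \<in> set es" "z \<in> set es" "fst (snd z) \<subseteq> snd (snd y)"
        "word_braid (fst z) = \<Delta>"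
      from arg_cong[OF yz(4), of exponent_sum] have "length (fst z) = 6"
        by (simp add: Garside_def)
      with yz table simple_table_extremes(4) have "snd (snd y) = UNIV" by blast
      with yz table simple_table_extremes(2) show "word_braid (fst y) = \<Delta>" by blast
    qed
    with e ends show False by (cases es) (auto simp: ss)
  qed
  ultimately have proper: "\<forall>e\<in>set es. proper_factor e"
    using table assms(3) by (auto simp: proper_factor_def ss)
  have prod: "prod_list ss = word_braid (concat (map fst es))"
    by (simp add: ss word_braid_concat o_def)
  have eq: "burau4 (word_braid (concat (map fst es))) = burau4 (inverse (\<Delta> powi p))"
  proof -
    have "burau4 (prod_list ss) = burau4 (inverse (\<Delta> powi p)) ** burau4 x"
      by (simp add: x flip: burau4_mult)
    then show ?thesis by (simp add: triv prod)
  qed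
  show False
  proof (cases "es = []")
    case True
    \<comment> \<open>A pure power of \<Delta> is detected by its level \<open>- 4 * p\<close>,
      which must be the level 0 of the identity.\<close>
    then have "top_rows (mat 1) (- 4 * p) UNIV"
      using eq top_rows_Garside_powi[of p] by (simp add: burau4_one)
    from top_rows_unique(1)[OF this top_rows_mat_1] have "p = 0" by simp
    with True x assms(1) show False by (simp add: ss)
  next
    case False
    with burau4_chain_neq[OF proper succ top_rows_Garside_powi[of p]] eq show False by simp
  qed
qed

end
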